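(* Let $q$ be a prime power. If $f$ is an additive function $\mathrm{GF}(q^2)\to\mathrm{GF}(q^2)$, then the set $X$ of projective points of the algebraic plane curve of affine equation $$\mathrm{Tr}(y+f(x))=\mathrm{N}(x)$$ is a regular set of pointed type in $\mathrm{PG}(2,q^2)$. Moreover, in every parallel class of lines the number of $k$-secants to $X$ is a multiple of $q$ for each integer $k$.
   Context: $\mathrm{Tr}$ and $\mathrm{N}$ denote the functions $\mathrm{GF}(q^2)\to\mathrm{GF}(q)$, $x\mapsto x+x^q$ and $x\mapsto x^{q+1}$, respectively. Let $\ell_\infty$ be the line at infinity and $(\infty)=(0:1:0)$ the common ideal point of the vertical lines $x=\alpha$. The set $X$ of projective points of the curve consists of the affine points $(x,y)\in\mathrm{GF}(q^2)^2$ satisfying the equation together with the only point at infinity of the curve, which is $(\infty)$. A parallel class of lines is the set of all affine lines (lines other than $\ell_\infty$) through a given point of $\ell_\infty$. A line is a $k$-secant of $X$ if it meets $X$ in exactly $k$ points. Definition (applied with $Q=q^2$). A point set $X$ of $\mathrm{PG}(2,Q)$ is regular of pointed type $[t;m_1,\ldots,m_h]$, where $t>0$, if there are a distinguished point $P_0\in X$ and a line $\ell_0$ with $\ell_0\cap X=\{P_0\}$ such that: (i) every line not through $P_0$ is an $m_i$-secant of $X$ for some $i\in\{1,\ldots,h\}$; (ii) for each $i$, the number of $m_i$-secants of $X$ incident with $P$ is the same for each $P\in\ell_0\setminus\{P_0\}$; (iii) all lines incident with $P_0$ other than $\ell_0$ are $(t+1)$-secants of $X$. "Regular of pointed type" means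 regular of pointed type $[t;m_1,\ldots,m_h]$ for some such parameters. The distinguished point is always taken to be $P_0=(\infty)$ and $\ell_0=\ell_\infty$. *)

theory Defs
  imports "HOL-Analysis.Cartesian_Space" "HOL-Number_Theory.Prime_Powers"
begin

(* The projective plane PG(2,Q) over the finite field 'a of order Q: its points and lines are the
   one- and two-dimensional subspaces of 'a^3, and incidence is inclusion. *)

definition pg_points :: "('a::{field,finite} ^ 3) set set" where
  "pg_points = {P. vec.subspace P \<and> vec.dim P = 1}"

definition pg_lines :: "('a::{field,finite} ^ 3) set set" where
  "pg_lines = {L. vec.subspace L \<and> vec.dim L = 2}"

(* The point (x : y : z); it belongs to pg_points only if the three coordinates are not all 0. *)
definition hom_point :: "'a::{field,finite} \<Rightarrow> 'a \<Rightarrow> 'a \<Rightarrow> ('a ^ 3) set" where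
  "hom_point x y z = vec.span {vector [x, y, z]}"

(* The affine point (x, y) is (x : y : 1), so the line at infinity is z = 0. *)
definition line_inf :: "('a::{field,finite} ^ 3) set" where
  "line_inf = {v. v $ 3 = 0}"

definition point_inf :: "('a::{field,finite} ^ 3) set" where
  "point_inf = hom_point 0 1 0"

(* The number k of a k-secant is an integer; there are no k-secants for k < 0. *)
definition is_secant ::
    "('a::{field,finite} ^ 3) set set \<Rightarrow> int \<Rightarrow> ('a ^ 3) set \<Rightarrow> bool" where
  "is_secant X k L \<longleftrightarrow> L \<in> pg_lines \<and> int (card {P \<in> X. P \<subseteq> L}) = k"

definition parallel_class :: "('a::{field,finite} ^ 3) set \<Rightarrow> ('a ^ 3) set set" where
  "parallel_class P = {L \<in> pg_lines. L \<noteq> line_inf \<and> P \<subseteq> L}"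

definition parallel_classes :: "('a::{field,finite} ^ 3) set set set" where
  "parallel_classes = parallel_class ` {P \<in> pg_points. P \<subseteq> line_inf}"

(* X is regular of pointed type [t; m_1, ..., m_h], where ms = [m_1, ..., m_h], with distinguished
   point P0 and distinguished line l0. The line l0 itself is among the lines counted in the
   fifth conjunct (condition (ii)). *)
definition regular_pointed_type ::
    "('a::{field,finite} ^ 3) set \<Rightarrow> ('a ^ 3) set \<Rightarrow> ('a ^ 3) set set \<Rightarrow> nat \<Rightarrow> nat list \<Rightarrow> bool" where
  "regular_pointed_type P0 l0 X t ms \<longleftrightarrow>
     X \<subseteq> pg_points \<and> t > 0 \<and>
     (P0 \<in> X \<and> l0 \<in> pg_lines \<and> {P \<in> X. P \<subseteq> l0} = {P0}) \<and>
     (\<forall>L \<in> pg_lines. \<not> P0 \<subseteq> L \<longrightarrow> (\<exists>m \<in> set ms. is_secant X (int m) L)) \<and>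
     (\<forall>m \<in> set ms. \<exists>c. \<forall>P \<in> pg_points. P \<subseteq> l0 \<and> P \<noteq> P0 \<longrightarrow>
        card {L \<in> pg_lines. P \<subseteq> L \<and> is_secant X (int m) L} = c) \<and>
     (\<forall>L \<in> pg_lines. P0 \<subseteq> L \<and> L \<noteq> l0 \<longrightarrow> is_secant X (int (t + 1)) L)"

(* Trace and norm from GF(q^2) to its subfield GF(q) = {x. x ^ q = x}, with values in GF(q^2). *)
definition gf_trace :: "nat \<Rightarrow> 'a::{field,finite} \<Rightarrow> 'a" where
  "gf_trace q x = x + x ^ q"

definition gf_norm :: "nat \<Rightarrow> 'a::{field,finite} \<Rightarrow> 'a" where
  "gf_norm q x = x ^ (q + 1)"

(* The projective points of the curve Tr(y + f(x)) = N(x); its only point at infinity is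
   (0 : 1 : 0). *)
definition curve_points ::
    "nat \<Rightarrow> ('a::{field,finite} \<Rightarrow> 'a) \<Rightarrow> ('a ^ 3) set set" where
  "curve_points q f =
     {hom_point x y 1 | x y. gf_trace q (y + f x) = gf_norm q x} \<union> {point_inf}"

end

theory Submission
  imports Defs "HOL-Computational_Algebra.Polynomial" "HOL-Number_Theory.Residues"
begin

text \<open>
  Every vertical line meets the curve in \<open>q\<close> affine points and \<open>(0 : 1 : 0)\<close>, because the trace maps
  onto \<open>GF(q)\<close> with all fibres of size \<open>q\<close>. So condition (iii) holds with \<open>t = q\<close>, and the content
  lies in the lines \<open>y = m x + b\<close>, whose intersection number with the curve is
  \<open>n(m, b) = card {x. Tr (m x + b + f x) = N x}\<close> (\<open>slope_count\<close>).

  The trace is additive, so \<open>n(m, b)\<close> depends on \<open>b\<close> only through \<open>Tr b\<close>. For a fixed slope the set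
  of \<open>b\<close> with \<open>n(m, b) = k\<close> is therefore a union of fibres of the trace, and its size is a multiple
  of \<open>q\<close> (\<open>dvd_card_slope_count\<close>).

  For condition (ii), substitute \<open>x + u\<close> for \<open>x\<close>. Since \<open>f\<close> is additive and
  \<open>N (x + u) = N x + Tr (u\<^sup>q x) + N u\<close>, the substitution changes the linear term \<open>m x\<close> into
  \<open>(m - u\<^sup>q) x\<close> and otherwise only adds constants. The constant \<open>N u\<close> lies in \<open>GF(q)\<close>, so it is the
  trace of some \<open>w\<close>, and all constants can be absorbed into \<open>b\<close>:
  \<open>n(m, b) = n(m - u\<^sup>q, b + m u + f u - w)\<close> (\<open>slope_count_shift\<close> gives the case \<open>m = u\<^sup>q\<close>). The map
  \<open>u \<mapsto> u\<^sup>q\<close> is onto, so every slope can be moved to \<open>0\<close>, at the price of a translation of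
  \<open>b\<close>, which preserves the distribution of the intersection numbers (\<open>card_slope_count_indep\<close>).

  The rest is the translation between subspaces of dimension one and two in \<open>GF(q\<^sup>2)\<^sup>3\<close> and these
  coordinates.
\<close>

section \<open>Finite fields of square order\<close>

text \<open>
  Multiplication by a nonzero \<open>x\<close> permutes the nonzero elements, so their product does not change
  when each factor is multiplied by \<open>x\<close>.
\<close>
lemma finite_field_power_card:
  fixes x :: "'a::{field,finite}"
  shows "x ^ CARD('a) = x"
proof (cases "x = 0")
  case False
  let ?U = "UNIV - {0 :: 'a}"
  have "\<Prod>?U = (\<Prod>y\<in>?U. x * y)"
    by (rule prod.reindex_bij_witness[of _ "\<lambda>y. x * y" "\<lambda>y. y / x"]) (use False in auto)
  also have "\<dots> = x ^ card ?U * \<Prod>?U"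
    by (simp add: prod.distrib)
  finally have "x ^ card ?U = 1"
    by simp
  moreover have "CARD('a) = Suc (card ?U)"
    by (simp add: card_Diff_singleton)
  ultimately show ?thesis
    by (simp only: power_Suc mult_1_right)
qed simp

lemma finite_field_CHAR_eq:
  assumes "CARD('a::{field,finite}) = p ^ n" and "prime p"
  shows "CHAR('a) = p"
proof -
  have prime: "prime CHAR('a)"
    by (rule prime_CHAR_semidom) (simp add: finite_imp_CHAR_pos)
  have "CHAR('a) dvd p ^ n"
    using CHAR_dvd_CARD[where ?'a = 'a] assms(1) by simp
  then show ?thesis
    using prime assms(2) by (meson prime_dvd_power primes_dvd_imp_eq)
qed


text \<open>
  Used for the whole field, where it gives the order of the image of the trace, and for sets of
  intercepts, where it gives divisibility by \<open>q\<close>.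
\<close>
lemma card_eq_fibre_card_mult:
  fixes T :: "'b::finite \<Rightarrow> 'c"
  assumes fibre: "\<And>b. b \<in> S \<Longrightarrow> card {b'. T b' = T b} = n"
    and saturated: "\<And>b b'. b \<in> S \<Longrightarrow> T b' = T b \<Longrightarrow> b' \<in> S"
  shows "card S = card (T ` S) * n"
proof -
  have "card S = (\<Sum>t\<in>T ` S. card {b \<in> S. T b = t})"
    using sum.image_gen[of S "\<lambda>_. 1 :: nat" T] by simp
  also have "\<dots> = (\<Sum>t\<in>T ` S. n)"
  proof (rule sum.cong[OF refl])
    fix t assume "t \<in> T ` S"
    then obtain b where b: "b \<in> S" "t = T b" by auto
    then have "{b' \<in> S. T b' = t} = {b'. T b' = T b}"
      using saturated by auto
    then show "card {b' \<in> S. T b' = t} = n"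
      using fibre b by simp
  qed
  finally show ?thesis by simp
qed

locale trace_norm_curve =
  fixes q :: nat and f :: "'a::{field,finite} \<Rightarrow> 'a"
  assumes primepow_q: "primepow q"
    and card_field: "CARD('a) = q\<^sup>2"
    and f_add: "f (x + y) = f x + f y"
begin

lemma q_gt_1: "q > 1"
  using primepow_gt_Suc_0[OF primepow_q] by simp

lemma frobenius_add: "(x + y :: 'a) ^ q = x ^ q + y ^ q"
proof -
  obtain p n where pn: "prime p" "q = p ^ n"
    using primepow_q by (auto simp: primepow_def)
  then have "CARD('a) = p ^ (n * 2)"
    by (simp add: card_field power_mult)
  then have "CHAR('a) = p"
    using finite_field_CHAR_eq pn by blast
  then show ?thesis
    using freshmans_dream'[where ?'a = 'a] pn by blast
qed

lemma frobenius_involution: "(x ^ q) ^ q = (x :: 'a)"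
  using finite_field_power_card[of x] by (simp add: card_field power2_eq_square power_mult)

lemma trace_add: "gf_trace q (x + y :: 'a) = gf_trace q x + gf_trace q y"
  by (simp add: gf_trace_def frobenius_add)

lemma trace_diff: "gf_trace q (x - y :: 'a) = gf_trace q x - gf_trace q y"
  using trace_add[of "x - y" y] by simp

lemma trace_frobenius: "gf_trace q x ^ q = (gf_trace q x :: 'a)"
  by (simp add: gf_trace_def frobenius_add frobenius_involution)

lemma norm_frobenius: "gf_norm q x ^ q = (gf_norm q x :: 'a)"
  by (simp add: gf_norm_def power_mult_distrib frobenius_involution)

text \<open>
  The polarisation of the norm is the trace form; this is why a translation in \<open>x\<close> acts on the
  curve as a change of slope.
\<close>
lemma norm_add:
  "gf_norm q (x + u :: 'a) = gf_norm q x + gf_trace q (x * u ^ q) + gf_norm q u"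
  by (simp add: gf_norm_def gf_trace_def frobenius_add power_mult_distrib
      frobenius_involution algebra_simps)

lemma trace_fibre_translate:
  "card {y :: 'a. gf_trace q y = gf_trace q b} = card {y :: 'a. gf_trace q y = 0}"
proof (rule bij_betw_same_card)
  show "bij_betw (\<lambda>y. y - b) {y. gf_trace q y = gf_trace q b} {y :: 'a. gf_trace q y = 0}"
    by (rule bij_betw_byWitness[where f' = "\<lambda>y. y + b"]) (auto simp: trace_add trace_diff)
qed

lemma card_trace_kernel_le: "card {y :: 'a. gf_trace q y = 0} \<le> q"
proof -
  let ?p = "Polynomial.monom 1 q + Polynomial.monom 1 1 :: 'a poly"
  have "degree (Polynomial.monom 1 1 :: 'a poly) < degree (Polynomial.monom 1 q :: 'a poly)"
    using q_gt_1 by (simp add: degree_monom_eq)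
  then have deg: "degree ?p = q"
    by (simp add: degree_add_eq_left degree_monom_eq)
  then have "?p \<noteq> 0"
    using q_gt_1 by auto
  then have "card {x. poly ?p x = 0} \<le> degree ?p"
    by (rule card_poly_roots_bound)
  then show ?thesis
    unfolding deg by (simp add: poly_monom gf_trace_def add.commute)
qed

lemma card_frobenius_fixed_le: "card {y :: 'a. y ^ q = y} \<le> q"
proof -
  let ?p = "Polynomial.monom 1 q - Polynomial.monom 1 1 :: 'a poly"
  have "degree (- Polynomial.monom 1 1 :: 'a poly) < degree (Polynomial.monom 1 q :: 'a poly)"
    using q_gt_1 by (simp add: degree_monom_eq)
  then have "degree (Polynomial.monom 1 q + - Polynomial.monom 1 1 :: 'a poly) = q"
    by (subst degree_add_eq_left) (simp_all add: degree_monom_eq)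
  then have deg: "degree ?p = q"
    by simp
  then have "?p \<noteq> 0"
    using q_gt_1 by auto
  then have "card {x. poly ?p x = 0} \<le> degree ?p"
    by (rule card_poly_roots_bound)
  then show ?thesis
    unfolding deg by (simp add: poly_monom)
qed

text \<open>
  The kernel consists of roots of \<open>X\<^sup>q + X\<close> and the image of roots of \<open>X\<^sup>q - X\<close>, so both have at most
  \<open>q\<close> elements. The product of their sizes is \<open>q\<^sup>2\<close>, hence both bounds are attained, and the image is all
  of \<open>GF(q)\<close>.
\<close>
lemma card_trace_fibre_and_range:
  "card {y :: 'a. gf_trace q y = gf_trace q b} = q"
  "range (gf_trace q) = {y :: 'a. y ^ q = y}"
proof -
  let ?R = "range (gf_trace q) :: 'a set" and ?K = "{y :: 'a. gf_trace q y = 0}"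
  have "CARD('a) = card ?R * card ?K"
    by (rule card_eq_fibre_card_mult) (auto simp: trace_fibre_translate)
  then have prod: "q * q = card ?R * card ?K"
    by (simp add: card_field power2_eq_square)
  have sub: "?R \<subseteq> {y. y ^ q = y}"
    by (auto simp: trace_frobenius)
  then have "card ?R \<le> card {y :: 'a. y ^ q = y}"
    by (simp add: card_mono)
  then have R: "card ?R \<le> q"
    using card_frobenius_fixed_le by simp
  have K: "card ?K = q"
  proof (rule ccontr)
    assume "card ?K \<noteq> q"
    then have "card ?K < q"
      using card_trace_kernel_le by simp
    then have "q * card ?K < q * q"
      using q_gt_1 by simp
    then have "card ?R * card ?K < q * q"
      using mult_le_mono1[OF R] by (rule le_less_trans[rotated])
    then show False using prod by simp
  qed
  then have "card ?R = q"
    using prod q_gt_1 by simp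
  then show "?R = {y. y ^ q = y}"
    using sub card_frobenius_fixed_le by (intro card_seteq) auto
  show "card {y :: 'a. gf_trace q y = gf_trace q b} = q"
    using K trace_fibre_translate by simp
qed

lemma trace_fibre_card:
  assumes "c ^ q = (c :: 'a)"
  shows "card {y. gf_trace q y = c} = q"
  using assms card_trace_fibre_and_range by (metis (mono_tags) mem_Collect_eq rangeE)

section \<open>Intersection numbers with the non-vertical lines\<close>

definition slope_count :: "'a \<Rightarrow> 'a \<Rightarrow> nat" where
  "slope_count m b = card {x. gf_trace q (m * x + b + f x) = gf_norm q x}"

lemma slope_count_cong:
  "gf_trace q b' = gf_trace q b \<Longrightarrow> slope_count m b' = slope_count m b"
  by (simp add: slope_count_def trace_add)

lemma slope_count_le: "slope_count m b \<le> q\<^sup>2"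
  unfolding slope_count_def card_field[symmetric] by (simp add: card_mono)

text \<open>
  The set of intercepts is a union of fibres of the trace.
\<close>
lemma dvd_card_slope_count: "q dvd card {b. slope_count m b = k}"
proof -
  have "card {b. slope_count m b = k} = card (gf_trace q ` {b. slope_count m b = k}) * q"
    using card_trace_fibre_and_range(1) slope_count_cong
    by (intro card_eq_fibre_card_mult) (blast, metis mem_Collect_eq)
  then show ?thesis by simp
qed

text \<open>
  After substituting \<open>x + u\<close> for \<open>x\<close> in the equation that is counted on the left, the linear part
  \<open>Tr (u\<^sup>q x)\<close> cancels against the mixed term of \<open>N (x + u)\<close>, and \<open>- w\<close> accounts for \<open>N u\<close>.
\<close>
lemma slope_count_shift:
  assumes w: "gf_trace q w = gf_norm q u"
  shows "slope_count (u ^ q) b = slope_count 0 (b + u ^ q * u + f u - w)"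
  unfolding slope_count_def
proof (rule bij_betw_same_card)
  have eq: "gf_trace q (u ^ q * (x + u) + b + f (x + u)) = gf_norm q (x + u) \<longleftrightarrow>
    gf_trace q (0 * x + (b + u ^ q * u + f u - w) + f x) = gf_norm q x" for x
  proof -
    have "gf_trace q (u ^ q * (x + u) + b + f (x + u)) =
        gf_trace q (x * u ^ q) + gf_trace q (u ^ q * u) + gf_trace q b
        + gf_trace q (f x) + gf_trace q (f u)"
      by (simp add: f_add trace_add distrib_left mult.commute[of x "u ^ q"])
    moreover have "gf_trace q (0 * x + (b + u ^ q * u + f u - w) + f x) =
        gf_trace q b + gf_trace q (u ^ q * u) + gf_trace q (f u) - gf_norm q u + gf_trace q (f x)"
      by (simp only: trace_add trace_diff w mult_zero_left add_0_left)
    ultimately show ?thesis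
      by (simp only: norm_add) (auto simp: algebra_simps)
  qed
  show "bij_betw (\<lambda>x. x - u)
     {x. gf_trace q (u ^ q * x + b + f x) = gf_norm q x}
     {x. gf_trace q (0 * x + (b + u ^ q * u + f u - w) + f x) = gf_norm q x}"
    (is "bij_betw _ ?A ?B")
  proof (rule bij_betw_byWitness[where f' = "\<lambda>x. x + u"])
    show "(\<lambda>x. x - u) ` ?A \<subseteq> ?B"
    proof
      fix y assume "y \<in> (\<lambda>x. x - u) ` ?A"
      then have "y + u \<in> ?A" by auto
      then show "y \<in> ?B" using eq[of y] by simp
    qed
    show "(\<lambda>x. x + u) ` ?B \<subseteq> ?A"
      using eq by auto
  qed simp_all
qed

text \<open>
  The intersection numbers for slope \<open>m\<close> are a translate of those for slope \<open>0\<close>, which gives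
  condition (ii) for the lines other than the line at infinity.
\<close>
lemma card_slope_count_indep:
  "card {b. slope_count m b = k} = card {b. slope_count 0 b = k}"
proof -
  (* The Frobenius map is an involution, so this u solves u ^ q = m. *)
  define u where "u = m ^ q"
  have u: "u ^ q = m"
    by (simp add: u_def frobenius_involution)
  obtain w :: 'a where w: "gf_trace q w = gf_norm q u"
    using card_trace_fibre_and_range(2) norm_frobenius[of u]
    by (metis (mono_tags) mem_Collect_eq rangeE)
  define s where "s = m * u + f u - w"
  have shift: "slope_count m b = slope_count 0 (b + s)" for b
    using slope_count_shift[OF w, of b] by (simp add: u s_def algebra_simps)
  show ?thesis
    by (rule bij_betw_same_card,
        rule bij_betw_byWitness[where f = "\<lambda>b. b + s" and f' = "\<lambda>b. b - s"])
       (auto simp: shift)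
qed

end

section \<open>Coordinates for the lines and points of the plane\<close>

definition slope_line :: "'a::{field,finite} \<Rightarrow> 'a \<Rightarrow> ('a ^ 3) set" where
  "slope_line m b = {v. v $ 2 = m * v $ 1 + b * v $ 3}"

definition vertical_line :: "'a::{field,finite} \<Rightarrow> ('a ^ 3) set" where
  "vertical_line a = {v. v $ 1 = a * v $ 3}"

lemma vec3_eq_iff: "v = w \<longleftrightarrow> v $ 1 = w $ 1 \<and> v $ 2 = w $ 2 \<and> v $ 3 = (w :: 'a ^ 3) $ 3"
  by (simp add: vec_eq_iff forall_3)

lemma mem_hom_point:
  "v \<in> hom_point x y z \<longleftrightarrow> (\<exists>k. v $ 1 = k * x \<and> v $ 2 = k * y \<and> v $ 3 = k * z)"
  by (auto simp: hom_point_def vec.span_singleton vec3_eq_iff)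

lemma hom_point_scale:
  assumes "c \<noteq> 0"
  shows "hom_point (c * x) (c * y) (c * z) = hom_point x y z"
proof -
  have "v \<in> hom_point (c * x) (c * y) (c * z)" if "v \<in> hom_point x y z" for v
  proof -
    obtain k where "v $ 1 = k * x" "v $ 2 = k * y" "v $ 3 = k * z"
      using \<open>v \<in> hom_point x y z\<close> by (auto simp: mem_hom_point)
    then show ?thesis
      using assms by (auto simp: mem_hom_point intro!: exI[of _ "k / c"])
  qed
  moreover have "v \<in> hom_point x y z" if "v \<in> hom_point (c * x) (c * y) (c * z)" for v
  proof -
    obtain k where "v $ 1 = k * (c * x)" "v $ 2 = k * (c * y)" "v $ 3 = k * (c * z)"
      using \<open>v \<in> hom_point (c * x) (c * y) (c * z)\<close> by (auto simp: mem_hom_point)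
    then show ?thesis
      by (auto simp: mem_hom_point intro!: exI[of _ "k * c"])
  qed
  ultimately show ?thesis by blast
qed

lemma hom_point_subset_iff:
  assumes "vec.subspace L"
  shows "hom_point x y z \<subseteq> L \<longleftrightarrow> vector [x, y, z] \<in> L"
  unfolding hom_point_def
  using vec.span_minimal[OF _ assms] vec.span_base by blast

lemma pg_line_subspace: "L \<in> pg_lines \<Longrightarrow> vec.subspace L"
  by (simp add: pg_lines_def)

lemma hom_point_in_pg_points: "x \<noteq> 0 \<or> y \<noteq> 0 \<or> z \<noteq> 0 \<Longrightarrow> hom_point x y z \<in> pg_points"
proof -
  assume "x \<noteq> 0 \<or> y \<noteq> 0 \<or> z \<noteq> 0"
  then have "vec.independent {vector [x, y, z] :: 'a ^ 3}"
    by (auto simp: vec3_eq_iff)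
  from vec.dim_span_eq_card_independent[OF this] show ?thesis
    by (simp add: pg_points_def hom_point_def)
qed

text \<open>
  The condition that \<open>u\<close> is not a multiple of a nonzero \<open>w\<close> is linear independence of the pair in a
  form that can be checked coordinatewise.
\<close>
lemma plane_in_pg_lines:
  fixes u w :: "'a::{field,finite} ^ 3"
  assumes "vec.subspace L" and "L \<subseteq> vec.span {u, w}" and "u \<in> L" "w \<in> L"
    and "w \<noteq> 0" and "\<And>k. u \<noteq> k *s w"
  shows "L \<in> pg_lines"
proof -
  have "vec.independent {u, w}"
    using assms by (auto simp: vec.independent_insert vec.span_singleton)
  moreover have "u \<noteq> w"
    using assms(6)[of 1] by auto
  moreover have "L = vec.span {u, w}"
    using assms vec.span_minimal[of "{u, w}" L] by auto
  ultimately show ?thesis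
    using assms(1) vec.dim_span_eq_card_independent[of "{u, w}"] by (simp add: pg_lines_def)
qed

lemma mem_span_pairI: "v = k *s u + l *s w \<Longrightarrow> v \<in> vec.span {u, w}"
  by (simp add: vec.span_add vec.span_scale vec.span_base)

lemma slope_line_in_pg_lines: "slope_line m b \<in> pg_lines"
proof (rule plane_in_pg_lines)
  let ?u = "vector [1, m, 0] :: 'a ^ 3" and ?w = "vector [0, b, 1] :: 'a ^ 3"
  show "vec.subspace (slope_line m b)"
    by (auto simp: vec.subspace_def slope_line_def algebra_simps)
  show "slope_line m b \<subseteq> vec.span {?u, ?w}"
  proof
    fix v assume "v \<in> slope_line m b"
    then show "v \<in> vec.span {?u, ?w}"
      by (intro mem_span_pairI[of _ "v $ 1" _ "v $ 3"]) (simp add: vec3_eq_iff slope_line_def)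
  qed
qed (auto simp: slope_line_def vec3_eq_iff)

lemma vertical_line_in_pg_lines: "vertical_line a \<in> pg_lines"
proof (rule plane_in_pg_lines)
  let ?u = "vector [a, 0, 1] :: 'a ^ 3" and ?w = "vector [0, 1, 0] :: 'a ^ 3"
  show "vec.subspace (vertical_line a)"
    by (auto simp: vec.subspace_def vertical_line_def algebra_simps)
  show "vertical_line a \<subseteq> vec.span {?u, ?w}"
  proof
    fix v assume "v \<in> vertical_line a"
    then show "v \<in> vec.span {?u, ?w}"
      by (intro mem_span_pairI[of _ "v $ 3" _ "v $ 2"]) (simp add: vec3_eq_iff vertical_line_def)
  qed
qed (auto simp: vertical_line_def vec3_eq_iff)

lemma line_inf_in_pg_lines: "line_inf \<in> pg_lines"
proof (rule plane_in_pg_lines)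
  let ?u = "vector [1, 0, 0] :: 'a ^ 3" and ?w = "vector [0, 1, 0] :: 'a ^ 3"
  show "vec.subspace (line_inf :: ('a ^ 3) set)"
    by (auto simp: vec.subspace_def line_inf_def)
  show "line_inf \<subseteq> vec.span {?u, ?w}"
  proof
    fix v :: "'a ^ 3" assume "v \<in> line_inf"
    then show "v \<in> vec.span {?u, ?w}"
      by (intro mem_span_pairI[of _ "v $ 1" _ "v $ 2"]) (simp add: vec3_eq_iff line_inf_def)
  qed
qed (auto simp: line_inf_def vec3_eq_iff)

lemma pg_line_eqI:
  assumes "L \<in> pg_lines" "M \<in> pg_lines" "L \<subseteq> M"
  shows "L = M"
  using assms by (intro vec.subspace_dim_equal) (auto simp: pg_lines_def)

text \<open>
  Two lines of the plane meet. Of two basis vectors, either one already has coordinate \<open>i\<close> equal to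
  \<open>0\<close>, or that coordinate of the first can be eliminated with the second.
\<close>
lemma pg_line_meets_coordinate_line:
  assumes "L \<in> pg_lines"
  obtains v where "v \<in> L" "v \<noteq> 0" "v $ i = 0"
proof -
  have sub: "vec.subspace L" and dim: "vec.dim L = 2"
    using assms by (auto simp: pg_lines_def)
  obtain B where B: "B \<subseteq> L" "vec.independent B" "card B = 2"
    using vec.basis_exists[of L] dim by metis
  then obtain u w where uw: "B = {u, w}" "u \<noteq> w"
    by (auto simp: card_2_iff)
  show thesis
  proof (cases "w $ i = 0")
    case True
    have "w \<noteq> 0"
      using B uw vec.dependent_zero[of B] by auto
    then show thesis
      using that True B uw by auto
  next
    case False
    let ?v = "u - (u $ i / w $ i) *s w"
    have "?v \<noteq> 0"
      using B uw by (auto simp: vec.independent_insert vec.span_singleton)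
    moreover have "?v \<in> L"
      using B uw sub by (auto intro!: vec.subspace_diff vec.subspace_scale)
    moreover have "?v $ i = 0"
      using False by simp
    ultimately show thesis
      using that by blast
  qed
qed

lemma point_inf_subset_iff: "vec.subspace L \<Longrightarrow> point_inf \<subseteq> L \<longleftrightarrow> vector [0, 1, 0] \<in> L"
  by (simp add: point_inf_def hom_point_subset_iff)

text \<open>
  The points of \<open>L\<close> with \<open>z = 0\<close> and with \<open>x = 0\<close> give slope and intercept: a vector of \<open>L\<close> with
  \<open>x = z = 0\<close> must vanish, so \<open>L\<close> is spanned by representatives of these two points.
\<close>
lemma pg_line_avoiding_point_inf:
  assumes L: "L \<in> pg_lines" and "\<not> point_inf \<subseteq> L"
  obtains m b where "L = slope_line m b"
proof -
  have sub: "vec.subspace L"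
    using L by (rule pg_line_subspace)
  have e2: "v = 0" if "v \<in> L" "v $ 1 = 0" "v $ 3 = 0" for v
  proof (rule ccontr)
    assume "v \<noteq> 0"
    then have "v $ 2 \<noteq> 0"
      using that by (auto simp: vec3_eq_iff)
    then have "(1 / v $ 2) *s v = vector [0, 1, 0]"
      using that by (simp add: vec3_eq_iff)
    then have "vector [0, 1, 0] \<in> L"
      using vec.subspace_scale[OF sub that(1)] by metis
    then show False
      using assms(2) sub by (simp add: point_inf_subset_iff)
  qed
  obtain u where u: "u \<in> L" "u \<noteq> 0" "u $ 3 = 0"
    using pg_line_meets_coordinate_line[OF L] by blast
  obtain w where w: "w \<in> L" "w \<noteq> 0" "w $ 1 = 0"
    using pg_line_meets_coordinate_line[OF L] by blast
  have nz: "u $ 1 \<noteq> 0" "w $ 3 \<noteq> 0"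
    using e2 u w by auto
  have "L \<subseteq> slope_line (u $ 2 / u $ 1) (w $ 2 / w $ 3)"
  proof
    fix v assume v: "v \<in> L"
    have "v - (v $ 1 / u $ 1) *s u - (v $ 3 / w $ 3) *s w = 0"
      using u w v nz sub by (intro e2) (auto intro!: vec.subspace_diff vec.subspace_scale)
    then have "v = (v $ 1 / u $ 1) *s u + (v $ 3 / w $ 3) *s w"
      by (simp add: algebra_simps)
    then have "v $ 2 = (v $ 1 / u $ 1) * u $ 2 + (v $ 3 / w $ 3) * w $ 2"
      by (metis vector_add_component vector_smult_component)
    then show "v \<in> slope_line (u $ 2 / u $ 1) (w $ 2 / w $ 3)"
      by (simp add: slope_line_def mult.commute)
  qed
  then show thesis
    using that pg_line_eqI[OF L slope_line_in_pg_lines] by blast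
qed

text \<open>
  A vector of \<open>L\<close> with \<open>z \<noteq> 0\<close> fixes the ratio \<open>x / z\<close>; together with \<open>(0, 1, 0)\<close> it spans a
  vertical line.
\<close>
lemma pg_line_through_point_inf:
  assumes L: "L \<in> pg_lines" and "point_inf \<subseteq> L" and "L \<noteq> line_inf"
  obtains a where "L = vertical_line a"
proof -
  have sub: "vec.subspace L"
    using L by (rule pg_line_subspace)
  have e2: "vector [0, 1, 0] \<in> L"
    using assms(2) sub by (simp add: point_inf_subset_iff)
  obtain u where u: "u \<in> L" "u $ 3 \<noteq> 0"
    using assms(3) pg_line_eqI[OF L line_inf_in_pg_lines] by (auto simp: line_inf_def)
  have "vertical_line (u $ 1 / u $ 3) \<subseteq> L"
  proof
    fix v assume v: "v \<in> vertical_line (u $ 1 / u $ 3)"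
    let ?r = "v $ 3 / u $ 3"
    have "v = ?r *s u + (v $ 2 - ?r * u $ 2) *s vector [0, 1, 0]"
      using u v by (simp add: vec3_eq_iff vertical_line_def)
    also have "\<dots> \<in> L"
      using u e2 sub by (intro vec.subspace_add vec.subspace_scale)
    finally show "v \<in> L" .
  qed
  then show thesis
    using that pg_line_eqI[OF vertical_line_in_pg_lines L] by blast
qed

text \<open>
  After scaling, an ideal point is the point \<open>(0 : 1 : 0)\<close> or a slope \<open>(1 : m : 0)\<close>.
\<close>
lemma point_on_line_inf:
  assumes "P \<in> pg_points" and "P \<subseteq> line_inf" and "P \<noteq> point_inf"
  obtains m where "P = hom_point 1 m 0"
proof -
  have sub: "vec.subspace P" and dim: "vec.dim P = 1"
    using assms(1) by (auto simp: pg_points_def)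
  obtain B where B: "B \<subseteq> P" "P \<subseteq> vec.span B" "card B = 1"
    using vec.basis_exists[of P] dim by metis
  then obtain v where v: "B = {v}"
    by (auto simp: card_1_singleton_iff)
  then have P: "P = vec.span {v}"
    using B vec.span_minimal[OF _ sub] by blast
  have v3: "v $ 3 = 0"
    using B v assms(2) by (auto simp: line_inf_def)
  have nz: "v \<noteq> 0"
    using dim P by auto
  have "v = vector [v $ 1, v $ 2, 0]"
    using v3 by (simp add: vec3_eq_iff)
  then have hom: "P = hom_point (v $ 1) (v $ 2) 0"
    unfolding hom_point_def P by simp
  have "v $ 1 \<noteq> 0"
  proof
    assume v1: "v $ 1 = 0"
    then have "v $ 2 \<noteq> 0"
      using nz v3 by (simp add: vec3_eq_iff)
    then have "P = point_inf"
      using hom_point_scale[of "v $ 2" 0 1 0] hom v1 by (simp add: point_inf_def)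
    then show False
      using assms(3) by simp
  qed
  then have "P = hom_point 1 (v $ 2 / v $ 1) 0"
    using hom_point_scale[of "v $ 1" 1 "v $ 2 / v $ 1" 0] hom by simp
  then show thesis by (rule that)
qed

section \<open>The curve\<close>

lemma point_inf_subset_vertical_line: "point_inf \<subseteq> vertical_line a"
  using pg_line_subspace[OF vertical_line_in_pg_lines, of a]
  by (simp add: point_inf_subset_iff) (simp add: vertical_line_def)

lemma point_inf_not_subset_slope_line: "\<not> point_inf \<subseteq> slope_line m b"
  using pg_line_subspace[OF slope_line_in_pg_lines, of m b]
  by (simp add: point_inf_subset_iff) (simp add: slope_line_def)

lemma point_inf_subset_line_inf: "point_inf \<subseteq> line_inf"
  by (simp add: point_inf_subset_iff[OF pg_line_subspace[OF line_inf_in_pg_lines]])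
    (simp add: line_inf_def)

lemma affine_point_subset_slope_line:
  "hom_point x y 1 \<subseteq> slope_line m b \<longleftrightarrow> y = m * x + b"
  using pg_line_subspace[OF slope_line_in_pg_lines, of m b]
  by (simp add: hom_point_subset_iff) (simp add: slope_line_def)

lemma affine_point_subset_vertical_line:
  "hom_point x y 1 \<subseteq> vertical_line a \<longleftrightarrow> x = a"
  using pg_line_subspace[OF vertical_line_in_pg_lines, of a]
  by (simp add: hom_point_subset_iff) (simp add: vertical_line_def)

lemma affine_point_not_subset_line_inf: "\<not> hom_point x y 1 \<subseteq> line_inf"
  by (simp add: hom_point_subset_iff[OF pg_line_subspace[OF line_inf_in_pg_lines]])
    (simp add: line_inf_def)

lemma ideal_point_subset_slope_line:
  "hom_point 1 m 0 \<subseteq> slope_line m' b \<longleftrightarrow> m = m'"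
  using pg_line_subspace[OF slope_line_in_pg_lines, of m' b]
  by (simp add: hom_point_subset_iff) (simp add: slope_line_def)

lemma ideal_point_not_subset_vertical_line: "\<not> hom_point 1 m 0 \<subseteq> vertical_line a"
  using pg_line_subspace[OF vertical_line_in_pg_lines, of a]
  by (simp add: hom_point_subset_iff) (simp add: vertical_line_def)

lemma ideal_point_subset_line_inf: "hom_point 1 m 0 \<subseteq> line_inf"
  by (simp add: hom_point_subset_iff[OF pg_line_subspace[OF line_inf_in_pg_lines]])
    (simp add: line_inf_def)

lemma affine_point_eq_iff: "hom_point x y 1 = hom_point x' y' 1 \<longleftrightarrow> x = x' \<and> y = y'"
proof
  assume eq: "hom_point x y 1 = hom_point x' y' 1"
  have "vector [x, y, 1] \<in> hom_point x y 1"
    by (auto simp: mem_hom_point intro!: exI[of _ 1])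
  then have "vector [x, y, 1] \<in> hom_point x' y' 1"
    by (simp only: eq)
  then show "x = x' \<and> y = y'"
    by (auto simp: mem_hom_point)
qed simp

lemma slope_line_eq_iff: "slope_line m b = slope_line m' b' \<longleftrightarrow> m = m' \<and> b = b'"
proof
  assume eq: "slope_line m b = slope_line m' b'"
  have "hom_point 1 m 0 \<subseteq> slope_line m' b'" "hom_point 0 b 1 \<subseteq> slope_line m' b'"
    unfolding eq[symmetric]
    by (simp_all add: ideal_point_subset_slope_line affine_point_subset_slope_line)
  then show "m = m' \<and> b = b'"
    by (simp add: ideal_point_subset_slope_line affine_point_subset_slope_line)
qed simp

lemma vertical_line_eq_iff: "vertical_line a = vertical_line a' \<longleftrightarrow> a = a'"
  by (metis affine_point_subset_vertical_line)

lemma vertical_line_neq_line_inf: "vertical_line a \<noteq> line_inf"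
  by (metis ideal_point_not_subset_vertical_line ideal_point_subset_line_inf)

lemma slope_line_neq_line_inf: "slope_line m b \<noteq> line_inf"
  by (metis point_inf_not_subset_slope_line point_inf_subset_line_inf)

lemma parallel_class_point_inf: "parallel_class point_inf = range vertical_line"
proof
  show "parallel_class point_inf \<subseteq> range vertical_line"
    unfolding parallel_class_def using pg_line_through_point_inf by blast
  show "range vertical_line \<subseteq> parallel_class point_inf"
    by (simp add: image_subset_iff parallel_class_def vertical_line_in_pg_lines
        vertical_line_neq_line_inf point_inf_subset_vertical_line)
qed

lemma parallel_class_ideal_point: "parallel_class (hom_point 1 m 0) = range (slope_line m)"
proof
  show "parallel_class (hom_point 1 m 0) \<subseteq> range (slope_line m)"
  proof
    fix L assume "L \<in> parallel_class (hom_point 1 m 0)"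
    then have L: "L \<in> pg_lines" "L \<noteq> line_inf" "hom_point 1 m 0 \<subseteq> L"
      by (auto simp: parallel_class_def)
    then have "\<not> point_inf \<subseteq> L"
      using pg_line_through_point_inf ideal_point_not_subset_vertical_line by metis
    then obtain m' b where "L = slope_line m' b"
      using pg_line_avoiding_point_inf L(1) by blast
    then show "L \<in> range (slope_line m)"
      using L(3) by (simp add: ideal_point_subset_slope_line)
  qed
  show "range (slope_line m) \<subseteq> parallel_class (hom_point 1 m 0)"
    by (simp add: image_subset_iff parallel_class_def slope_line_in_pg_lines
        slope_line_neq_line_inf ideal_point_subset_slope_line)
qed

context trace_norm_curve
begin

lemma curve_points_on_slope_line:
  "card {P \<in> curve_points q f. P \<subseteq> slope_line m b} = slope_count m b"
proof -
  let ?A = "{x. gf_trace q (m * x + b + f x) = gf_norm q x}"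
  have "{P \<in> curve_points q f. P \<subseteq> slope_line m b} = (\<lambda>x. hom_point x (m * x + b) 1) ` ?A"
    by (rule Set.set_eqI) (auto simp: curve_points_def affine_point_subset_slope_line
        point_inf_not_subset_slope_line del: subsetI)
  moreover have "inj_on (\<lambda>x. hom_point x (m * x + b) 1) ?A"
    by (auto simp: inj_on_def affine_point_eq_iff)
  ultimately show ?thesis
    by (simp add: slope_count_def card_image)
qed

text \<open>
  The summand \<open>1\<close> is the point at infinity; the affine points form a translate of a fibre of the
  trace, over \<open>N a \<in> GF(q)\<close>.
\<close>
lemma curve_points_on_vertical_line:
  "card {P \<in> curve_points q f. P \<subseteq> vertical_line a} = q + 1"
proof -
  let ?A = "{y. gf_trace q (y + f a) = gf_norm q a}"
  have "card ?A = card {y. gf_trace q y = gf_norm q a}"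
  proof (rule bij_betw_same_card)
    show "bij_betw (\<lambda>y. y + f a) ?A {y. gf_trace q y = gf_norm q a}"
      by (rule bij_betw_byWitness[where f' = "\<lambda>y. y - f a"]) auto
  qed
  then have card_A: "card ?A = q"
    by (simp add: trace_fibre_card norm_frobenius)
  have "{P \<in> curve_points q f. P \<subseteq> vertical_line a} =
      insert point_inf ((\<lambda>y. hom_point a y 1) ` ?A)"
    by (rule Set.set_eqI) (auto simp: curve_points_def affine_point_subset_vertical_line
        point_inf_subset_vertical_line del: subsetI)
  moreover have "point_inf \<notin> (\<lambda>y. hom_point a y 1) ` ?A"
    using point_inf_subset_line_inf affine_point_not_subset_line_inf by (metis imageE)
  moreover have "inj_on (\<lambda>y. hom_point a y 1) ?A"
    by (auto simp: inj_on_def affine_point_eq_iff)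
  ultimately show ?thesis
    using card_A by (simp add: card_image)
qed

lemma curve_points_on_line_inf: "{P \<in> curve_points q f. P \<subseteq> line_inf} = {point_inf}"
  by (auto simp: curve_points_def affine_point_not_subset_line_inf
      dest: point_inf_subset_line_inf[THEN subsetD])

lemma is_secant_slope_line:
  "is_secant (curve_points q f) k (slope_line m b) \<longleftrightarrow> int (slope_count m b) = k"
  by (simp add: is_secant_def slope_line_in_pg_lines curve_points_on_slope_line)

lemma is_secant_vertical_line:
  "is_secant (curve_points q f) k (vertical_line a) \<longleftrightarrow> int (q + 1) = k"
  by (simp add: is_secant_def vertical_line_in_pg_lines curve_points_on_vertical_line)

lemma card_secants_ideal_parallel_class:
  "card {L \<in> parallel_class (hom_point 1 m 0). is_secant (curve_points q f) k L} =
    card {b. int (slope_count m b) = k}"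
proof -
  have "{L \<in> parallel_class (hom_point 1 m 0). is_secant (curve_points q f) k L} =
      slope_line m ` {b. int (slope_count m b) = k}"
    by (auto simp: parallel_class_ideal_point is_secant_slope_line)
  moreover have "inj_on (slope_line m) {b. int (slope_count m b) = k}"
    by (simp add: inj_on_def slope_line_eq_iff)
  ultimately show ?thesis
    by (simp add: card_image)
qed

text \<open>
  All \<open>q\<^sup>2\<close> vertical lines are \<open>(q + 1)\<close>-secants, so each count is \<open>q\<^sup>2\<close> or \<open>0\<close>.
\<close>
lemma dvd_card_secants_vertical:
  "q dvd card {L \<in> parallel_class (point_inf :: ('a ^ 3) set). is_secant (curve_points q f) k L}"
proof (cases "int (q + 1) = k")
  case True
  then have "{L \<in> parallel_class point_inf. is_secant (curve_points q f) k L} =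
      range (vertical_line :: 'a \<Rightarrow> _)"
    by (auto simp: parallel_class_point_inf is_secant_vertical_line)
  moreover have "inj (vertical_line :: 'a \<Rightarrow> _)"
    by (simp add: inj_on_def vertical_line_eq_iff)
  ultimately show ?thesis
    by (simp add: card_image card_field)
next
  case False
  then have "{L \<in> parallel_class (point_inf :: ('a ^ 3) set).
      is_secant (curve_points q f) k L} = {}"
    by (auto simp: parallel_class_point_inf is_secant_vertical_line)
  then show ?thesis
    by (simp only: card.empty dvd_0_right)
qed

lemma secants_in_parallel_class:
  assumes "C \<in> (parallel_classes :: ('a ^ 3) set set set)"
  shows "q dvd card {L \<in> C. is_secant (curve_points q f) k L}"
proof -
  obtain P :: "('a ^ 3) set" where P: "P \<in> pg_points" "P \<subseteq> line_inf"
    and C: "C = parallel_class P"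
    using assms by (auto simp: parallel_classes_def)
  show ?thesis
  proof (cases "P = point_inf")
    case True
    then show ?thesis
      using dvd_card_secants_vertical C by simp
  next
    case False
    then obtain m where m: "P = hom_point 1 m 0"
      using point_on_line_inf P by blast
    have "q dvd card {b. int (slope_count m b) = k}"
    proof (cases "k < 0")
      case True
      then have "{b. int (slope_count m b) = k} = {}"
        by auto
      then show ?thesis
        by (simp only: card.empty dvd_0_right)
    next
      case False
      then have "{b. int (slope_count m b) = k} = {b. slope_count m b = nat k}"
        by auto
      then show ?thesis
        using dvd_card_slope_count by simp
    qed
    then show ?thesis
      by (simp only: C m card_secants_ideal_parallel_class)
  qed
qed

text \<open>
  The extra summand is the line at infinity, which passes through every ideal point and is a
  \<open>1\<close>-secant. It occurs equally often for all of them, so the count does not depend on \<open>m\<close>.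
\<close>
lemma card_secants_through_ideal_point:
  "card {L \<in> pg_lines. hom_point 1 m 0 \<subseteq> L \<and> is_secant (curve_points q f) (int k) L} =
    card {b. slope_count 0 b = k} + (if k = 1 then 1 else 0)"
proof -
  let ?S = "{L \<in> parallel_class (hom_point 1 m 0). is_secant (curve_points q f) (int k) L}"
  let ?I = "if k = 1 then {line_inf :: ('a ^ 3) set} else {}"
  have inf: "is_secant (curve_points q f) (int k) line_inf \<longleftrightarrow> k = 1"
    by (auto simp: is_secant_def line_inf_in_pg_lines curve_points_on_line_inf)
  have split: "{L \<in> pg_lines. hom_point 1 m 0 \<subseteq> L \<and> is_secant (curve_points q f) (int k) L} =
      ?S \<union> ?I"
    using inf ideal_point_subset_line_inf[of m] line_inf_in_pg_lines[where ?'a = 'a]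
    by (auto simp: parallel_class_def split: if_splits)
  have "line_inf \<notin> ?S"
    by (simp add: parallel_class_def)
  then have "card (?S \<union> ?I) = card ?S + card ?I"
    by (intro card_Un_disjoint) auto
  also have "card ?S = card {b. slope_count m b = k}"
    by (simp add: card_secants_ideal_parallel_class)
  finally show ?thesis
    unfolding split by (simp add: card_slope_count_indep[of m])
qed

text \<open>
  All numbers from \<open>0\<close> to \<open>q\<^sup>2\<close> may be listed as secant numbers, since condition (ii) holds for each
  \<open>k\<close> separately, including those \<open>k\<close> for which there are no \<open>k\<close>-secants.
\<close>
lemma regular_pointed_type_curve:
  "regular_pointed_type point_inf line_inf (curve_points q f) q [0..<Suc (q\<^sup>2)]"
  unfolding regular_pointed_type_def
proof (intro conjI ballI impI)
  show "curve_points q f \<subseteq> pg_points"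
    by (auto simp: curve_points_def point_inf_def intro!: hom_point_in_pg_points)
  show "0 < q"
    using q_gt_1 by simp
  show "point_inf \<in> curve_points q f"
    by (simp add: curve_points_def)
  show "(line_inf :: ('a ^ 3) set) \<in> pg_lines"
    by (rule line_inf_in_pg_lines)
  show "{P \<in> curve_points q f. P \<subseteq> line_inf} = {point_inf}"
    by (rule curve_points_on_line_inf)
next
  fix L :: "('a ^ 3) set" assume "L \<in> pg_lines" "\<not> point_inf \<subseteq> L"
  then obtain m b where "L = slope_line m b"
    by (rule pg_line_avoiding_point_inf)
  then show "\<exists>n\<in>set [0..<Suc (q\<^sup>2)]. is_secant (curve_points q f) (int n) L"
    using slope_count_le[of m b]
    by (intro bexI[of _ "slope_count m b"]) (auto simp: is_secant_slope_line)
next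
  fix k
  show "\<exists>c. \<forall>P\<in>pg_points. P \<subseteq> line_inf \<and> P \<noteq> point_inf \<longrightarrow>
      card {L \<in> pg_lines. P \<subseteq> L \<and> is_secant (curve_points q f) (int k) L} = c"
  proof (intro exI ballI impI)
    fix P :: "('a ^ 3) set"
    assume "P \<in> pg_points" "P \<subseteq> line_inf \<and> P \<noteq> point_inf"
    then obtain m where "P = hom_point 1 m 0"
      using point_on_line_inf by blast
    then show "card {L \<in> pg_lines. P \<subseteq> L \<and> is_secant (curve_points q f) (int k) L} =
        card {b. slope_count 0 b = k} + (if k = 1 then 1 else 0)"
      using card_secants_through_ideal_point by simp
  qed
next
  fix L :: "('a ^ 3) set" assume "L \<in> pg_lines" "point_inf \<subseteq> L \<and> L \<noteq> line_inf"
  then obtain a where "L = vertical_line a"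
    using pg_line_through_point_inf by blast
  then show "is_secant (curve_points q f) (int (q + 1)) L"
    by (simp add: is_secant_vertical_line)
qed

end

theorem theorem2p7:
  fixes q :: nat and f :: "'a::{field,finite} \<Rightarrow> 'a"
  assumes "primepow q"
    and "CARD('a) = q\<^sup>2"
    and "\<And>x y. f (x + y) = f x + f y"
  shows "(\<exists>t ms. regular_pointed_type point_inf line_inf (curve_points q f) t ms) \<and>
    (\<forall>C \<in> parallel_classes. \<forall>k :: int. q dvd card {L \<in> C. is_secant (curve_points q f) k L})"
proof -
  interpret trace_norm_curve q f
    using assms by unfold_locales
  show ?thesis
    using regular_pointed_type_curve secants_in_parallel_class by blast
qed

end
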